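(* Let $q$ be the distribution of target data on a paired training dataset, let $\mathbf{x}_{\rm cond}(\mathbf{y})$ be the condition data paired with the target data $\mathbf{y}$, and let $p$ be the push-forward of $q$ under $\mathbf{x}_{\rm cond}$, i.e. $p(\mathbf{x})=\sum_{\{\mathbf{y}:\,\mathbf{x}_{\rm cond}(\mathbf{y})=\mathbf{x}\}}q(\mathbf{y})$. Let $$\mathcal{J}_{\rm DSM}(\theta)=\mathbb{E}_t w_t\,\mathbb{E}_{\mathbf{y}_0\sim q}\,\mathbb{E}_{\mathbf{y}_t\sim p_{t|0}(\mathbf{y}_t|\mathbf{y}_0)}\left\Vert s_\theta(\mathbf{y}_t;\mathbf{x}_{\rm cond}(\mathbf{y}_0),t)-\nabla_{\mathbf{y}_t}\log p_{t|0}(\mathbf{y}_t|\mathbf{y}_0)\right\Vert_2^2 .$$ Let $\mathcal{C}(\mathbf{x},\mathbf{y})=\frac{1}{p(\mathbf{x})}\delta(\mathbf{x}-\mathbf{x}_{\rm cond}(\mathbf{y}))$, where $\delta$ is the Dirac delta function. Then $$\mathcal{J}_{\rm DSM}(\theta)=\mathbb{E}_t w_t\,\mathbb{E}_{\mathbf{x}\sim p}\,\mathbb{E}_{\mathbf{y}\sim q}\,\mathcal{C}(\mathbf{x},\mathbf{y})\,\mathbb{E}_{\mathbf{y}_t\sim p_{t|0}(\mathbf{y}_t|\mathbf{y})}\left\Vert s_\theta(\mathbf{y}_t;\mathbf{x},t)-\nabla_{\mathbf{y}_t}\log p_{t|0}(\mathbf{y}_t|\mathbf{y})\right\Vert_2^2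 .$$ Furthermore, $\gamma(\mathbf{x},\mathbf{y})=\mathcal{C}(\mathbf{x},\mathbf{y})\,p(\mathbf{x})\,q(\mathbf{y})$ is a joint distribution with marginal distributions $p$ (in $\mathbf{x}$) and $q$ (in $\mathbf{y}$).
   Context: The training dataset is finite; $q$ is a probability distribution on the (finitely many) target training samples in $\mathbb{R}^D$, $q(\mathbf{y})$ is the mass of $\mathbf{y}$, and each target sample $\mathbf{y}$ is assigned exactly one condition $\mathbf{x}_{\rm cond}(\mathbf{y})$ (several $\mathbf{y}$ may share a condition). $p(\mathbf{x})$ is the mass of the condition $\mathbf{x}$. Convention for $\delta$: it acts as a unit point mass, so that $\int\varphi(\mathbf{x})\,\delta(\mathbf{x}-\mathbf{x}_{\rm cond}(\mathbf{y}))\,d\mathbf{x}=\varphi(\mathbf{x}_{\rm cond}(\mathbf{y}))$ for every function $\varphi$, and, as a function of $\mathbf{y}$, $\delta(\mathbf{x}-\mathbf{x}_{\rm cond}(\mathbf{y}))=\sum_{\{\mathbf{y}':\,\mathbf{x}_{\rm cond}(\mathbf{y}')=\mathbf{x}\}}\delta(\mathbf{y}-\mathbf{y}')$. On the finite dataset, with integrals read as sums over the dataset, $\delta(\mathbf{x}-\mathbf{x}_{\rm cond}(\mathbf{y}))$ equals $1$ if $\mathbf{x}=\mathbf{x}_{\rm cond}(\mathbf{y})$ and $0$ otherwise, and expectations over $p$ and $q$ are weighted sums with weights $p(\mathbf{x})$, $q(\mathbf{y})$. The time $t$ is uniformly distributed on $[0,T]$, and $w_t\ge 0$ is a weight. $p_{t|0}(\cdot|\mathbf{y}_0)$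 is the conditional density of $\mathbf{y}_t$ given the initial state $\mathbf{y}_0$ for the forward SDE $d\mathbf{y}_t=f(\mathbf{y}_t,t)\,dt+g(t)\,d\mathbf{w}$, $t\in[0,T]$, with $\mathbf{w}$ a standard Wiener process in $\mathbb{R}^D$, $f(\cdot,t):\mathbb{R}^D\to\mathbb{R}^D$ and $g(t)\in\mathbb{R}$. $s_\theta(\mathbf{y};\mathbf{x},t)\in\mathbb{R}^D$ is a model with parameters $\theta$ (the conditional score-based model). *)

theory Defs
  imports "HOL-Probability.Probability"
begin

section \<open>Stochastic differential equations with deterministic scalar diffusion\<close>

text \<open>
  The noise is a standard Wiener process relative to a filtration \<open>F\<close>, so that solutions may start
  at a random \<open>F 0\<close>-measurable point. Only the indices \<open>t \<ge> 0\<close> of \<open>F\<close> and \<open>W\<close> matter.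
\<close>

definition wiener_process ::
  "'w measure \<Rightarrow> (real \<Rightarrow> 'w measure) \<Rightarrow> (real \<Rightarrow> 'w \<Rightarrow> real ^ 'd) \<Rightarrow> bool" where
  "wiener_process M F W \<longleftrightarrow>
     prob_space M \<and>
     filtration (space M) F \<and> (\<forall>t. subalgebra M (F t)) \<and>
     (\<forall>t\<ge>0. W t \<in> borel_measurable (F t)) \<and>
     (AE \<omega> in M. W 0 \<omega> = 0) \<and>
     (AE \<omega> in M. continuous_on {0..} (\<lambda>t. W t \<omega>)) \<and>
     (\<forall>s t. 0 \<le> s \<and> s < t \<longrightarrow>
        distributed M lborel (\<lambda>\<omega>. W t \<omega> - W s \<omega>)
          (\<lambda>z. ennreal (\<Prod>i\<in>UNIV. normal_density 0 (sqrt (t - s)) (z $ i))) \<and>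
        prob_space.indep_set M (sets (F s))
          {(\<lambda>\<omega>. W t \<omega> - W s \<omega>) -` A \<inter> space M | A. A \<in> sets borel})"

text \<open>
  As the integrand \<open>g\<close> does not depend on \<open>\<omega>\<close>, its Ito integral over \<open>[0,u]\<close> is the Wiener integral:
  the mean-square limit of the integrals of deterministic step functions that converge
  to \<open>g\<close> in \<open>L\<^sup>2[0,u]\<close>. It is determined up to almost sure equality.
\<close>

definition step_fun :: "nat \<Rightarrow> (nat \<Rightarrow> real) \<Rightarrow> (nat \<Rightarrow> real) \<Rightarrow> real \<Rightarrow> real" where
  "step_fun k \<tau> c r = (\<Sum>i<k. c i * indicator {\<tau> i<..\<tau> (Suc i)} r)"

definition step_integral ::
  "(real \<Rightarrow> 'w \<Rightarrow> real ^ 'd) \<Rightarrow> nat \<Rightarrow> (nat \<Rightarrow> real) \<Rightarrow> (nat \<Rightarrow> real) \<Rightarrow> 'w \<Rightarrow> real ^ 'd" where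
  "step_integral W k \<tau> c \<omega> = (\<Sum>i<k. c i *\<^sub>R (W (\<tau> (Suc i)) \<omega> - W (\<tau> i) \<omega>))"

definition is_wiener_integral ::
  "'w measure \<Rightarrow> (real \<Rightarrow> 'w \<Rightarrow> real ^ 'd) \<Rightarrow> (real \<Rightarrow> real) \<Rightarrow> real \<Rightarrow> ('w \<Rightarrow> real ^ 'd) \<Rightarrow> bool" where
  "is_wiener_integral M W g u I \<longleftrightarrow>
     set_borel_measurable lborel {0..u} g \<and> I \<in> borel_measurable M \<and>
     (\<exists>k \<tau> c.
        (\<forall>n. mono_on {..k n} (\<tau> n) \<and> \<tau> n ` {..k n} \<subseteq> {0..u}) \<and>
        ((\<lambda>n. \<integral>\<^sup>+ r\<in>{0..u}. ennreal ((g r - step_fun (k n) (\<tau> n) (c n) r)\<^sup>2) \<partial>lborel)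
           \<longlonglongrightarrow> 0) \<and>
        ((\<lambda>n. \<integral>\<^sup>+ \<omega>. ennreal ((norm (I \<omega> - step_integral W (k n) (\<tau> n) (c n) \<omega>))\<^sup>2) \<partial>M)
           \<longlonglongrightarrow> 0))"

text \<open>\<open>Y\<close> solves \<open>dY\<^sub>t = f(Y\<^sub>t,t) dt + g(t) dW\<^sub>t\<close> on \<open>[0,T]\<close>, in integrated form.\<close>

definition sde_solution ::
  "'w measure \<Rightarrow> (real \<Rightarrow> 'w measure) \<Rightarrow> (real \<Rightarrow> 'w \<Rightarrow> real ^ 'd) \<Rightarrow>
   (real ^ 'd \<Rightarrow> real \<Rightarrow> real ^ 'd) \<Rightarrow> (real \<Rightarrow> real) \<Rightarrow> real \<Rightarrow> (real \<Rightarrow> 'w \<Rightarrow> real ^ 'd) \<Rightarrow> bool" where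
  "sde_solution M F W f g T Y \<longleftrightarrow>
     wiener_process M F W \<and>
     (\<forall>t\<in>{0..T}. Y t \<in> borel_measurable (F t)) \<and>
     (AE \<omega> in M. continuous_on {0..T} (\<lambda>t. Y t \<omega>)) \<and>
     (\<forall>t\<in>{0..T}. \<exists>I. is_wiener_integral M W g t I \<and>
        (AE \<omega> in M. set_integrable lborel {0..t} (\<lambda>r. f (Y r \<omega>) r) \<and>
           Y t \<omega> = Y 0 \<omega> + (LINT r:{0..t}|lborel. f (Y r \<omega>) r) + I \<omega>))"

text \<open>
  \<open>h x\<close> is a density of \<open>Y\<close> conditionally on \<open>X = x\<close>, i.e.
  \<open>P(X \<in> A, Y \<in> B) = \<integral>\<^sub>A \<integral>\<^sub>B h x y dy P\<^sub>X(dx)\<close>. For a discrete \<open>X\<close> this determines \<open>h x\<close>, up to a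
  Lebesgue null set, at each atom \<open>x\<close> of \<open>X\<close>.
\<close>

definition conditional_density ::
  "'w measure \<Rightarrow> ('w \<Rightarrow> real ^ 'd) \<Rightarrow> ('w \<Rightarrow> real ^ 'd) \<Rightarrow> (real ^ 'd \<Rightarrow> real ^ 'd \<Rightarrow> real) \<Rightarrow> bool" where
  "conditional_density M X Y h \<longleftrightarrow>
     (\<lambda>(x, y). h x y) \<in> borel_measurable (borel \<Otimes>\<^sub>M borel) \<and> (\<forall>x y. 0 \<le> h x y) \<and>
     (\<forall>A\<in>sets borel. \<forall>B\<in>sets borel.
        emeasure M {\<omega> \<in> space M. X \<omega> \<in> A \<and> Y \<omega> \<in> B} =
        (\<integral>\<^sup>+ x\<in>A. (\<integral>\<^sup>+ y\<in>B. ennreal (h x y) \<partial>lborel) \<partial>distr M borel X))"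

section \<open>Denoising score matching\<close>

definition gradient :: "('a::real_inner \<Rightarrow> real) \<Rightarrow> 'a \<Rightarrow> 'a" where
  "gradient F y = (THE D. GDERIV F y :> D)"

text \<open>
  \<open>dsm_error h s \<theta> t x y0\<close> is the expectation over \<open>y\<^sub>t \<sim> h t y0\<close> of the squared distance between the
  model, conditioned on \<open>x\<close>, and the score. Expectations of nonnegative quantities
  are taken in \<open>[0,\<infinity>]\<close>, so that no integrability has to be assumed.
\<close>

definition dsm_error ::
  "(real \<Rightarrow> real ^ 'd \<Rightarrow> real ^ 'd \<Rightarrow> real) \<Rightarrow> ('\<theta> \<Rightarrow> real ^ 'd \<Rightarrow> 'c \<Rightarrow> real \<Rightarrow> real ^ 'd) \<Rightarrow> '\<theta> \<Rightarrow>
   real \<Rightarrow> 'c \<Rightarrow> real ^ 'd \<Rightarrow> ennreal" where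
  "dsm_error h s \<theta> t x y0 =
     (\<integral>\<^sup>+ yt. ennreal ((norm (s \<theta> yt x t - gradient (\<lambda>z. ln (h t y0 z)) yt))\<^sup>2)
        \<partial>density lborel (\<lambda>z. ennreal (h t y0 z)))"

definition J_DSM ::
  "real \<Rightarrow> (real \<Rightarrow> real) \<Rightarrow> (real ^ 'd) pmf \<Rightarrow> (real ^ 'd \<Rightarrow> 'c) \<Rightarrow>
   (real \<Rightarrow> real ^ 'd \<Rightarrow> real ^ 'd \<Rightarrow> real) \<Rightarrow> ('\<theta> \<Rightarrow> real ^ 'd \<Rightarrow> 'c \<Rightarrow> real \<Rightarrow> real ^ 'd) \<Rightarrow> '\<theta> \<Rightarrow>
   ennreal" where
  "J_DSM T w q x_cond h s \<theta> =
     (\<integral>\<^sup>+ t. ennreal (w t) * (\<integral>\<^sup>+ y0. dsm_error h s \<theta> t (x_cond y0) y0 \<partial>measure_pmf q)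
        \<partial>uniform_measure lborel {0..T})"

text \<open>
  On a finite dataset, where integrals are sums over the dataset, the Dirac delta is the unit point
  mass at \<open>0\<close>; the next two lemmas are its defining properties.
\<close>

definition dirac_delta :: "'c::ab_group_add \<Rightarrow> real" where
  "dirac_delta z = (if z = 0 then 1 else 0)"

lemma sum_dirac_delta:
  fixes \<phi> :: "'c::ab_group_add \<Rightarrow> real"
  assumes "finite S" "x0 \<in> S"
  shows "(\<Sum>x\<in>S. \<phi> x * dirac_delta (x - x0)) = \<phi> x0"
  using assms by (simp add: dirac_delta_def if_distrib sum.delta cong: if_cong)

lemma dirac_delta_fibre:
  fixes x_cond :: "'y::ab_group_add \<Rightarrow> 'c::ab_group_add"
  assumes "finite S" "y \<in> S"
  shows "dirac_delta (x - x_cond y) = (\<Sum>y'\<in>{y'\<in>S. x_cond y' = x}. dirac_delta (y - y'))"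
  using assms by (auto simp: dirac_delta_def eq_commute[of x] sum.delta')

definition cond_weight :: "'c pmf \<Rightarrow> ('y \<Rightarrow> 'c::ab_group_add) \<Rightarrow> 'c \<Rightarrow> 'y \<Rightarrow> real" where
  "cond_weight p x_cond x y = 1 / pmf p x * dirac_delta (x - x_cond y)"

lemma pmf_pushforward:
  assumes "finite S" "set_pmf q \<subseteq> S"
  shows "pmf (map_pmf x_cond q) x = (\<Sum>y\<in>{y\<in>S. x_cond y = x}. pmf q y)"
proof -
  have "pmf (map_pmf x_cond q) x = measure (measure_pmf q) (x_cond -` {x})"
    by (rule pmf_map)
  also have "\<dots> = measure (measure_pmf q) {y\<in>S. x_cond y = x}"
    by (rule measure_pmf.finite_measure_eq_AE)
       (use assms(2) in \<open>auto simp: AE_measure_pmf_iff\<close>)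
  also have "\<dots> = (\<Sum>y\<in>{y\<in>S. x_cond y = x}. pmf q y)"
    using assms(1) by (intro measure_measure_pmf_finite) auto
  finally show ?thesis .
qed

end

theory Submission
  imports Defs
begin

text \<open>
  The joint distribution \<open>\<gamma>\<close> is the law of \<open>(x_cond y, y)\<close> for \<open>y \<sim> q\<close>, i.e. \<open>q\<close> carried by the graph of
  \<open>x_cond\<close>. The identity for the loss holds already for each fixed \<open>t\<close>: exchanging the two
  expectations, the weight cancels the mass \<open>p(x)\<close> of the only condition paired with \<open>y\<close>.
\<close>

lemma pmf_map_eq_0D: "pmf q y = 0" if "pmf (map_pmf h q) (h y) = 0"
  using that by (auto simp: pmf_eq_0_set_pmf)

text \<open>Both iterated integrals are integrals against the product law
  \<open>pair_pmf p q\<close>, which is symmetric up to swapping coordinates. Every set is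
  measurable for a pmf, so \<open>\<Phi>\<close> may be arbitrary.\<close>

lemma nn_integral_pmf_swap:
  "(\<integral>\<^sup>+ x. (\<integral>\<^sup>+ y. \<Phi> x y \<partial>measure_pmf q) \<partial>measure_pmf p) =
   (\<integral>\<^sup>+ y. (\<integral>\<^sup>+ x. \<Phi> x y \<partial>measure_pmf p) \<partial>measure_pmf q)"
proof -
  have "(\<integral>\<^sup>+ x. (\<integral>\<^sup>+ y. \<Phi> x y \<partial>measure_pmf q) \<partial>measure_pmf p) =
        (\<integral>\<^sup>+ z. (case z of (x, y) \<Rightarrow> \<Phi> x y) \<partial>measure_pmf (pair_pmf p q))"
    by (simp add: nn_integral_pair_pmf')
  also have "\<dots> = (\<integral>\<^sup>+ y. (\<integral>\<^sup>+ x. \<Phi> x y \<partial>measure_pmf p) \<partial>measure_pmf q)"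
    by (subst pair_commute_pmf) (simp add: nn_integral_pair_pmf' case_prod_unfold)
  finally show ?thesis .
qed

text \<open>The delta leaves only the atom \<open>x_cond y\<close>, whose mass cancels the factor
  \<open>1 / pmf p (x_cond y)\<close>. The support assumption makes this mass nonzero; otherwise
  division by zero would give weight 0.\<close>

lemma nn_integral_cond_weight:
  fixes x_cond :: "'y \<Rightarrow> 'c::ab_group_add"
  assumes "x_cond y \<in> set_pmf p"
  shows "(\<integral>\<^sup>+ x. ennreal (cond_weight p x_cond x y) * \<Phi> x \<partial>measure_pmf p) = \<Phi> (x_cond y)"
proof -
  have pos: "0 < pmf p (x_cond y)"
    using assms by (simp add: pmf_positive_iff)
  have "(\<integral>\<^sup>+ x. ennreal (cond_weight p x_cond x y) * \<Phi> x \<partial>measure_pmf p) =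
        (\<integral>\<^sup>+ x. ennreal (1 / pmf p (x_cond y)) * \<Phi> (x_cond y) * indicator {x_cond y} x
           \<partial>measure_pmf p)"
    by (intro nn_integral_cong) (auto simp: cond_weight_def dirac_delta_def indicator_def)
  also have "\<dots> = ennreal (1 / pmf p (x_cond y)) * ennreal (pmf p (x_cond y)) * \<Phi> (x_cond y)"
    by (subst nn_integral_cmult_indicator) (simp_all add: emeasure_pmf_single mult_ac)
  also have "\<dots> = \<Phi> (x_cond y)"
    using pos by (simp flip: ennreal_mult)
  finally show ?thesis .
qed

text \<open>The loss identity at a fixed time, to be applied with \<open>\<Phi>\<close> equal to
  \<open>dsm_error p0 s \<theta> t\<close>.\<close>

lemma nn_integral_cond_weight_pushforward:
  fixes x_cond :: "'y \<Rightarrow> 'c::ab_group_add"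
  shows "(\<integral>\<^sup>+ x. (\<integral>\<^sup>+ y. ennreal (cond_weight (map_pmf x_cond q) x_cond x y) * \<Phi> x y
            \<partial>measure_pmf q) \<partial>measure_pmf (map_pmf x_cond q)) =
         (\<integral>\<^sup>+ y. \<Phi> (x_cond y) y \<partial>measure_pmf q)"
  \<comment> \<open>Only for \<open>y\<close> in the support of \<open>q\<close> is
    \<open>x_cond y\<close> known to lie in the support of the push-forward, hence equality almost
    everywhere. Rewriting with \<open>nn_integral_map_pmf\<close> would turn the inner integral into
    one over \<open>q\<close>, hiding the pattern of \<open>nn_integral_cond_weight\<close>.\<close>
  by (subst nn_integral_pmf_swap, rule nn_integral_cong_AE)
     (simp add: AE_measure_pmf_iff nn_integral_cond_weight del: nn_integral_map_pmf)

text \<open>The graph map is injective, so a point on the graph carries the mass of its second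
  coordinate; off the graph both sides vanish.\<close>

lemma pmf_graph_coupling:
  fixes x_cond :: "'y \<Rightarrow> 'c::ab_group_add"
  shows "pmf (map_pmf (\<lambda>y. (x_cond y, y)) q) (x, y) =
         cond_weight (map_pmf x_cond q) x_cond x y * pmf (map_pmf x_cond q) x * pmf q y"
proof (cases "x = x_cond y")
  case True
  have "pmf (map_pmf (\<lambda>y. (x_cond y, y)) q) (x_cond y, y) = pmf q y"
    by (rule pmf_map_inj') (simp add: inj_on_def)
  \<comment> \<open>If the condition has mass 0, the weight is 0 because \<open>1 / 0 = 0\<close>,
    and \<open>pmf q y\<close> is 0 as well.\<close>
  with True show ?thesis
    by (auto simp: cond_weight_def dirac_delta_def dest: pmf_map_eq_0D)
next
  case False
  then have "(x, y) \<notin> set_pmf (map_pmf (\<lambda>y. (x_cond y, y)) q)"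
    by auto
  then have "pmf (map_pmf (\<lambda>y. (x_cond y, y)) q) (x, y) = 0"
    by (rule iffD2[OF pmf_eq_0_set_pmf])
  with False show ?thesis
    by (simp add: cond_weight_def dirac_delta_def)
qed

theorem proposition1:
  fixes S :: "(real ^ 'd) set"
    and q :: "(real ^ 'd) pmf"
    and x_cond :: "real ^ 'd \<Rightarrow> 'c::ab_group_add"
    and p :: "'c pmf"
    and T :: real
    and w :: "real \<Rightarrow> real"
    and M :: "'w measure"
    and F :: "real \<Rightarrow> 'w measure"
    and W Y :: "real \<Rightarrow> 'w \<Rightarrow> real ^ 'd"
    and f :: "real ^ 'd \<Rightarrow> real \<Rightarrow> real ^ 'd"
    and g :: "real \<Rightarrow> real"
    and p0 :: "real \<Rightarrow> real ^ 'd \<Rightarrow> real ^ 'd \<Rightarrow> real"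
    and s :: "'\<theta> \<Rightarrow> real ^ 'd \<Rightarrow> 'c \<Rightarrow> real \<Rightarrow> real ^ 'd"
    and \<theta> :: '\<theta>
  assumes "finite S" and "set_pmf q \<subseteq> S"
    and "p = map_pmf x_cond q"
    and "0 < T" and "\<And>t. t \<in> {0..T} \<Longrightarrow> 0 \<le> w t"
    and "sde_solution M F W f g T Y"
    and "distr M borel (Y 0) = distr (measure_pmf q) borel (\<lambda>y. y)"
    and "\<And>t. t \<in> {0<..T} \<Longrightarrow> conditional_density M (Y 0) (Y t) (p0 t)"
  shows "J_DSM T w q x_cond p0 s \<theta> =
           (\<integral>\<^sup>+ t. ennreal (w t) *
              (\<integral>\<^sup>+ x. (\<integral>\<^sup>+ y. ennreal (cond_weight p x_cond x y) * dsm_error p0 s \<theta> t x y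
                 \<partial>measure_pmf q) \<partial>measure_pmf p)
              \<partial>uniform_measure lborel {0..T})
         \<and> (\<exists>\<gamma> :: ('c \<times> (real ^ 'd)) pmf.
              (\<forall>x y. pmf \<gamma> (x, y) = cond_weight p x_cond x y * pmf p x * pmf q y) \<and>
              map_pmf fst \<gamma> = p \<and> map_pmf snd \<gamma> = q)"
proof
  show "J_DSM T w q x_cond p0 s \<theta> =
          (\<integral>\<^sup>+ t. ennreal (w t) *
             (\<integral>\<^sup>+ x. (\<integral>\<^sup>+ y. ennreal (cond_weight p x_cond x y) * dsm_error p0 s \<theta> t x y
                \<partial>measure_pmf q) \<partial>measure_pmf p)
             \<partial>uniform_measure lborel {0..T})"
    by (simp only: J_DSM_def assms(3) nn_integral_cond_weight_pushforward)
next
  let ?\<gamma> = "map_pmf (\<lambda>y. (x_cond y, y)) q"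
  \<comment> \<open>Composing the graph map with the projections gives \<open>x_cond\<close> and the
    identity.\<close>
  have "map_pmf fst ?\<gamma> = p" "map_pmf snd ?\<gamma> = q"
    by (simp_all add: assms(3) pmf.map_comp o_def)
  then show "\<exists>\<gamma> :: ('c \<times> (real ^ 'd)) pmf.
      (\<forall>x y. pmf \<gamma> (x, y) = cond_weight p x_cond x y * pmf p x * pmf q y) \<and>
      map_pmf fst \<gamma> = p \<and> map_pmf snd \<gamma> = q"
    using pmf_graph_coupling[of x_cond q] unfolding assms(3) by blast
qed

end
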